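(* Let $\psi$ be a polynomial (a real polynomial, viewed as a map $\mathbb{R}\to\mathbb{R}$) of degree greater than one that possesses at least one repelling fixed point, i.e. there is $x_0\in\mathbb{R}$ such that $\psi(x_0)=x_0$ and $|\psi'(x_0)|>1$. Let $d>1$, $\omega(t)=|t|^{1/d}$ and $\sigma(t):=\omega(t^{1/2})$, $t\ge 0$. Then the family of iterates $\{C_{\psi_m}:\mathcal{S}_{\omega}(\mathbb{R})\to \mathcal{S}_{\sigma}(\mathbb{R}):m\in\mathbb{N}\}$ is not $m$-topologizable.
   Context: For a continuous increasing function $\omega:[0,\infty)\to[0,\infty)$ which is a weight function in the sense of Braun–Meise–Taylor (as are the powers $t^{1/r}$, $r>1$), put $\varphi_\omega(t):=\omega(e^t)$ and let $\varphi_\omega^*(s):=\sup\{st-\varphi_\omega(t): t\ge 0\}$, $s\ge 0$, be its Young conjugate. The space $\mathcal{S}_\omega(\mathbb{R})$ consists of all $f\in C^\infty(\mathbb{R})$ such that for every $\lambda>0$ $$p_{\omega,\lambda}(f):=\sup_{x\in\mathbb{R}}\sup_{n,q\in\mathbb{N}_0}(1+|x|)^q|f^{(n)}(x)|\exp\left(-\lambda\varphi_\omega^*\left(\tfrac{n+q}{\lambda}\right)\right)<\infty,$$ with the Fréchet topology given by the system of seminorms $\{p_{\omega,\lambda}:\lambda>0\}$. For a polynomial $\psi$, $\psi_m=\psi\circ\cdots\circ\psi$ ($m$ times), and $C_{\psi_m}f:=f\circ\psi_m$. (It is known that for $\omega$ sub-additive and every polynomial $\psi$ of degree greater than one, $C_\psi$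 maps $\mathcal{S}_\omega(\mathbb{R})$ continuously into $\mathcal{S}_{\omega(\bullet^{1/2})}(\mathbb{R})$.) For locally convex Hausdorff spaces $E,F$ with topologies determined by systems of continuous seminorms $cs(E)$, $cs(F)$ (here the systems $p_{\cdot,\lambda}$, $\lambda>0$), a family of continuous linear operators $\{T_m:E\to F: m\in\mathbb{N}\}$ is $m$-topologizable if for every $p\in cs(F)$ there are $q\in cs(E)$ and $C\ge 1$ such that $p(T_k x)\le C^k\,q(x)$ for all $k\in\mathbb{N}$ and all $x\in E$. *)

theory Defs
  imports "HOL-Analysis.Analysis" "HOL-Computational_Algebra.Polynomial"
begin

definition nth_vderiv :: "nat \<Rightarrow> (real \<Rightarrow> complex) \<Rightarrow> real \<Rightarrow> complex" where
  "nth_vderiv n f = ((\<lambda>g x. vector_derivative g (at x)) ^^ n) f"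

definition smooth :: "(real \<Rightarrow> complex) \<Rightarrow> bool" where
  "smooth f \<longleftrightarrow> (\<forall>n x. nth_vderiv n f differentiable (at x))"

definition phi :: "(real \<Rightarrow> real) \<Rightarrow> real \<Rightarrow> real" where
  "phi \<omega> t = \<omega> (exp t)"

(* The supremum is taken in the reals; it is meaningful because the set is bounded
   above for every weight function (log t = o(omega(t))), in particular for powers. *)
definition young_conj :: "(real \<Rightarrow> real) \<Rightarrow> real \<Rightarrow> real" where
  "young_conj \<phi> s = (SUP t\<in>{0..}. s * t - \<phi> t)"

(* Extended-valued, so that an infinite supremum is really infinity; membership in
   the space S_space below is finiteness of all these quantities. *)
definition p_seminorm :: "(real \<Rightarrow> real) \<Rightarrow> real \<Rightarrow> (real \<Rightarrow> complex) \<Rightarrow> ennreal" where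
  "p_seminorm \<omega> l f =
     (SUP x::real. SUP n::nat. SUP q::nat.
        ennreal ((1 + \<bar>x\<bar>) ^ q * norm (nth_vderiv n f x) *
                 exp (- l * young_conj (phi \<omega>) (real (n + q) / l))))"

definition S_seminorms :: "(real \<Rightarrow> real) \<Rightarrow> ((real \<Rightarrow> complex) \<Rightarrow> ennreal) set" where
  "S_seminorms \<omega> = {p_seminorm \<omega> l |l. l > 0}"

definition S_space :: "(real \<Rightarrow> real) \<Rightarrow> (real \<Rightarrow> complex) set" where
  "S_space \<omega> = {f. smooth f \<and> (\<forall>l>0. p_seminorm \<omega> l f < \<infinity>)}"

(* The locally convex topology on the function space E given by the seminorms in P:
   the open balls of the individual seminorms form a subbase. *)
definition lc_topology ::
  "(real \<Rightarrow> complex) set \<Rightarrow> ((real \<Rightarrow> complex) \<Rightarrow> ennreal) set \<Rightarrow> (real \<Rightarrow> complex) topology" where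
  "lc_topology E P = topology_generated_by
     {{g \<in> E. p (\<lambda>x. g x - f x) < ennreal r} |p f r. p \<in> P \<and> f \<in> E \<and> r > 0}"

definition cont_lin_op ::
  "(real \<Rightarrow> complex) set \<Rightarrow> ((real \<Rightarrow> complex) \<Rightarrow> ennreal) set \<Rightarrow>
   (real \<Rightarrow> complex) set \<Rightarrow> ((real \<Rightarrow> complex) \<Rightarrow> ennreal) set \<Rightarrow>
   ((real \<Rightarrow> complex) \<Rightarrow> (real \<Rightarrow> complex)) \<Rightarrow> bool" where
  "cont_lin_op E P F Q T \<longleftrightarrow>
     (\<forall>f\<in>E. T f \<in> F) \<and>
     (\<forall>f\<in>E. \<forall>g\<in>E. \<forall>a b. T (\<lambda>x. a * f x + b * g x) = (\<lambda>x. a * T f x + b * T g x)) \<and>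
     continuous_map (lc_topology E P) (lc_topology F Q) T"

(* This is the defining estimate only.  That every T k is a continuous linear operator
   between the two spaces is a separate assertion (cont_lin_op), so that negating
   m_topologizable does not negate it as well. *)
definition m_topologizable ::
  "'a set \<Rightarrow> ('a \<Rightarrow> ennreal) set \<Rightarrow> ('b \<Rightarrow> ennreal) set \<Rightarrow> (nat \<Rightarrow> 'a \<Rightarrow> 'b) \<Rightarrow> bool" where
  "m_topologizable E P Q T \<longleftrightarrow>
     (\<forall>p\<in>Q. \<exists>q\<in>P. \<exists>C::real. C \<ge> 1 \<and>
        (\<forall>k\<ge>1. \<forall>x\<in>E. p (T k x) \<le> ennreal (C ^ k) * q x))"

definition iter_comp_op :: "real poly \<Rightarrow> nat \<Rightarrow> (real \<Rightarrow> complex) \<Rightarrow> (real \<Rightarrow> complex)" where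
  "iter_comp_op \<psi> m f = f \<circ> (poly \<psi> ^^ m)"

end

theory Submission
  imports Defs "HOL-Complex_Analysis.Complex_Analysis"
begin

text \<open>Continuity: the derivative \<open>(f \<circ> P)\<^sup>(\<^sup>n\<^sup>)\<close> is a sum of terms \<open>c\<^sub>n\<^sub>j \<cdot> (f\<^sup>(\<^sup>j\<^sup>) \<circ> P)\<close> whose
  polynomial coefficients grow like \<open>n\<^bsup>n - j\<^esup> (1 + \<bar>x\<bar>)\<^bsup>j (N - 1)\<^esup>\<close>, where \<open>N = degree P\<close>, and
  \<open>(1 + \<bar>x\<bar>)\<^bsup>N\<^esup>\<close> is bounded by a multiple of \<open>1 + \<bar>P x\<bar>\<close>. Doubling the Gevrey exponent \<open>d\<close> then
  leaves a superexponential margin, so every seminorm of \<open>f \<circ> P\<close> is controlled by one and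
  the same seminorm of \<open>f\<close>.

  Failure of m-topologizability: if \<open>f\<close> vanishes to order exactly \<open>n\<close> at a fixed point \<open>x\<^sub>0\<close>
  with multiplier \<open>\<mu>\<close>, then the \<open>n\<close>-th derivative of \<open>f \<circ> \<psi>\<^sub>k\<close> at \<open>x\<^sub>0\<close> is \<open>\<mu>\<^bsup>k n\<^esup>\<close> times that of
  \<open>f\<close>. A bound \<open>C\<^sup>k\<close> that is uniform in \<open>f\<close> would force \<open>\<bar>\<mu>\<bar>\<^sup>n \<le> C\<close> for all \<open>n\<close>. Gaussians times
  powers provide such functions \<open>f\<close>.\<close>

section \<open>Iterated derivatives\<close>

lemma nth_vderiv_0 [simp]: "nth_vderiv 0 f = f"
  by (simp add: nth_vderiv_def)

lemma nth_vderiv_Suc: "nth_vderiv (Suc n) f x = vector_derivative (nth_vderiv n f) (at x)"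
  by (simp add: nth_vderiv_def)

lemma smooth_has_vector_derivative:
  assumes "smooth f"
  shows "(nth_vderiv n f has_vector_derivative nth_vderiv (Suc n) f x) (at x)"
  using assms unfolding smooth_def nth_vderiv_Suc vector_derivative_works[symmetric] by blast

text \<open>Closed formulas for derivatives of all orders are obtained below by writing down the
  whole family \<open>F\<close> and verifying one differentiation step; smoothness then follows from
  the same verification.\<close>

lemma nth_vderiv_tower:
  assumes "\<And>n x. (F n has_vector_derivative F (Suc n) x) (at x)"
  shows "nth_vderiv n (F 0) = F n"
proof (induction n)
  case (Suc n)
  then show ?case
    using vector_derivative_at[OF assms] by (auto simp: nth_vderiv_Suc)
qed simp

lemma smooth_tower:
  assumes "\<And>n x. (F n has_vector_derivative F (Suc n) x) (at x)"
  shows "smooth (F 0)"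
  unfolding smooth_def nth_vderiv_tower[of F, OF assms]
  using assms differentiableI_vector by blast

lemma
  assumes "smooth f" "smooth g"
  shows smooth_lincomb: "smooth (\<lambda>x. a * f x + b * g x)"
    and nth_vderiv_lincomb: "nth_vderiv n (\<lambda>x. a * f x + b * g x) =
          (\<lambda>x. a * nth_vderiv n f x + b * nth_vderiv n g x)"
proof -
  let ?F = "\<lambda>n x. a * nth_vderiv n f x + b * nth_vderiv n g x"
  have F: "(?F n has_vector_derivative ?F (Suc n) x) (at x)" for n x
    by (intro has_vector_derivative_add has_vector_derivative_mult_right
          smooth_has_vector_derivative assms)
  show "smooth (\<lambda>x. a * f x + b * g x)"
    using smooth_tower[of ?F, OF F] by simp
  show "nth_vderiv n (\<lambda>x. a * f x + b * g x) = ?F n"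
    using nth_vderiv_tower[of ?F, OF F] by simp
qed

text \<open>\<open>comp_coeff P n j\<close> is the factor of the \<open>j\<close>-th derivative of f
  at P x in the \<open>n\<close>-th derivative of f o P, that is, the partial Bell polynomial in the
  derivatives of P. The recursion (differentiate the coefficient, or let the derivative fall on f
  and gain a factor P') suits induction better than the closed formula of Faa di Bruno.\<close>

primrec comp_coeff :: "real poly \<Rightarrow> nat \<Rightarrow> nat \<Rightarrow> real poly" where
  "comp_coeff P 0 j = (if j = 0 then 1 else 0)"
| "comp_coeff P (Suc n) j = pderiv (comp_coeff P n j) +
     (case j of 0 \<Rightarrow> 0 | Suc i \<Rightarrow> pderiv P * comp_coeff P n i)"

lemma comp_coeff_eq_0: "n < j \<Longrightarrow> comp_coeff P n j = 0"
  by (induction n arbitrary: j) (auto split: nat.split)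

lemma comp_coeff_diag: "comp_coeff P n n = pderiv P ^ n"
  by (induction n) (auto simp: comp_coeff_eq_0)

lemma
  assumes "smooth f"
  shows smooth_comp_poly: "smooth (f \<circ> poly P)"
    and nth_vderiv_comp_poly: "nth_vderiv n (f \<circ> poly P) x =
          (\<Sum>j\<le>n. of_real (poly (comp_coeff P n j) x) * nth_vderiv j f (poly P x))"
proof -
  let ?F = "\<lambda>n x. \<Sum>j\<le>n. of_real (poly (comp_coeff P n j) x) * nth_vderiv j f (poly P x)"
  have F: "(?F n has_vector_derivative ?F (Suc n) x) (at x)" for n x
  proof -
    let ?c = "\<lambda>j. complex_of_real (poly (comp_coeff P n j) x)"
    let ?c' = "\<lambda>j. complex_of_real (poly (pderiv (comp_coeff P n j)) x)"
    let ?g = "\<lambda>j. nth_vderiv j f (poly P x)"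
    let ?p' = "complex_of_real (poly (pderiv P) x)"
    have 1: "((\<lambda>x. complex_of_real (poly (comp_coeff P n j) x)) has_vector_derivative ?c' j) (at x)" for j
      by (intro has_vector_derivative_of_real)
        (simp add: poly_DERIV flip: has_real_derivative_iff_has_vector_derivative)
    have "((nth_vderiv j f \<circ> poly P) has_vector_derivative
            poly (pderiv P) x *\<^sub>R nth_vderiv (Suc j) f (poly P x)) (at x)" for j
      by (intro vector_diff_chain_at smooth_has_vector_derivative assms)
        (simp add: poly_DERIV flip: has_real_derivative_iff_has_vector_derivative)
    then have 2: "((\<lambda>x. nth_vderiv j f (poly P x)) has_vector_derivative ?p' * ?g (Suc j)) (at x)" for j
      by (simp add: o_def scaleR_conv_of_real)
    have "(?F n has_vector_derivative (\<Sum>j\<le>n. ?c j * (?p' * ?g (Suc j)) + ?c' j * ?g j)) (at x)"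
      by (intro has_vector_derivative_sum has_vector_derivative_mult 1 2)
    moreover have "?F (Suc n) x = (\<Sum>j\<le>n. ?c j * (?p' * ?g (Suc j)) + ?c' j * ?g j)"
    proof -
      \<comment> \<open>The two sums are the two summands of the recursion for
        \<open>comp_coeff\<close>. The first loses its top term since
        \<open>comp_coeff P n (Suc n) = 0\<close>; the second loses its bottom term by an index
        shift.\<close>
      have "?F (Suc n) x = (\<Sum>j\<le>Suc n. ?c' j * ?g j) +
          (\<Sum>j\<le>Suc n. (case j of 0 \<Rightarrow> 0 | Suc i \<Rightarrow> ?c i * (?p' * ?g j)))"
        by (subst sum.distrib[symmetric], intro sum.cong)
          (auto simp: algebra_simps split: nat.split)
      also have "(\<Sum>j\<le>Suc n. ?c' j * ?g j) = (\<Sum>j\<le>n. ?c' j * ?g j)"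
        by (simp add: comp_coeff_eq_0)
      also have "(\<Sum>j\<le>Suc n. (case j of 0 \<Rightarrow> 0 | Suc i \<Rightarrow> ?c i * (?p' * ?g j))) =
          (\<Sum>j\<le>n. ?c j * (?p' * ?g (Suc j)))"
        by (subst sum.atMost_Suc_shift) simp
      finally show ?thesis
        by (simp only: sum.distrib add.commute)
    qed
    ultimately show ?thesis
      by simp
  qed
  have 0: "?F 0 = f \<circ> poly P"
    by (auto simp: fun_eq_iff)
  show "smooth (f \<circ> poly P)"
    using smooth_tower[of ?F, OF F] unfolding 0 .
  show "nth_vderiv n (f \<circ> poly P) x = ?F n x"
    using nth_vderiv_tower[of ?F, OF F, of n] unfolding 0 by (rule fun_cong)
qed

section \<open>Coefficient bounds and growth of polynomials\<close>

text \<open>The l1 norm of the coefficients: submultiplicative, and differentiation costs only a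
  factor \<open>degree p\<close>. The growth of \<open>comp_coeff\<close> can thus be tracked
  independently of the point x.\<close>

definition coeff_norm :: "real poly \<Rightarrow> real" where
  "coeff_norm p = (\<Sum>i\<le>degree p. \<bar>coeff p i\<bar>)"

lemma coeff_norm_nonneg [simp]: "0 \<le> coeff_norm p"
  by (simp add: coeff_norm_def sum_nonneg)

lemma coeff_norm_eq:
  assumes "degree p \<le> k"
  shows "coeff_norm p = (\<Sum>i\<le>k. \<bar>coeff p i\<bar>)"
  unfolding coeff_norm_def using assms
  by (intro sum.mono_neutral_left) (auto simp: coeff_eq_0)

lemma coeff_norm_0 [simp]: "coeff_norm 0 = 0"
  by (simp add: coeff_norm_def)

lemma coeff_norm_pCons [simp]: "coeff_norm (pCons a p) = \<bar>a\<bar> + coeff_norm p"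
proof -
  have "coeff_norm (pCons a p) = (\<Sum>i\<le>Suc (degree p). \<bar>coeff (pCons a p) i\<bar>)"
    by (rule coeff_norm_eq) (simp add: degree_pCons_le)
  then show ?thesis
    by (subst (asm) sum.atMost_Suc_shift) (simp add: coeff_norm_def)
qed

lemma coeff_norm_smult [simp]: "coeff_norm (smult a p) = \<bar>a\<bar> * coeff_norm p"
  by (induction p) (auto simp: abs_mult algebra_simps)

lemma coeff_norm_add: "coeff_norm (p + q) \<le> coeff_norm p + coeff_norm q"
proof -
  let ?k = "max (degree p) (degree q)"
  have "coeff_norm (p + q) = (\<Sum>i\<le>?k. \<bar>coeff (p + q) i\<bar>)"
    by (rule coeff_norm_eq) (rule degree_add_le_max)
  also have "\<dots> \<le> (\<Sum>i\<le>?k. \<bar>coeff p i\<bar> + \<bar>coeff q i\<bar>)"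
    by (intro sum_mono) (simp add: abs_triangle_ineq)
  finally show ?thesis
    by (simp add: sum.distrib coeff_norm_eq[of _ ?k])
qed

lemma coeff_norm_mult: "coeff_norm (p * q) \<le> coeff_norm p * coeff_norm q"
proof (induction p)
  case (pCons a p)
  have "coeff_norm (pCons a p * q) \<le> coeff_norm (smult a q) + coeff_norm (pCons 0 (p * q))"
    by (simp only: mult_pCons_left coeff_norm_add)
  with pCons show ?case
    by (simp add: algebra_simps)
qed simp

lemma coeff_norm_pderiv: "coeff_norm (pderiv p) \<le> degree p * coeff_norm p"
proof (cases "degree p")
  case 0
  then show ?thesis
    by (auto elim!: degree_eq_zeroE simp: pderiv_pCons)
next
  case (Suc k)
  have "coeff_norm (pderiv p) = (\<Sum>i\<le>k. Suc i * \<bar>coeff p (Suc i)\<bar>)"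
    using Suc by (subst coeff_norm_eq[of _ k]) (auto simp: degree_pderiv coeff_pderiv abs_mult)
  also have "\<dots> \<le> (\<Sum>i\<le>k. degree p * \<bar>coeff p (Suc i)\<bar>)"
    using Suc by (intro sum_mono mult_right_mono) auto
  also have "\<dots> \<le> degree p * coeff_norm p"
    unfolding coeff_norm_def Suc sum.atMost_Suc_shift
    by (simp add: sum_distrib_left algebra_simps)
  finally show ?thesis .
qed

lemma abs_poly_le:
  assumes "degree p \<le> k"
  shows "\<bar>poly p x\<bar> \<le> coeff_norm p * (1 + \<bar>x\<bar>) ^ k"
proof -
  have "\<bar>poly p x\<bar> \<le> (\<Sum>i\<le>degree p. \<bar>coeff p i\<bar> * \<bar>x\<bar> ^ i)"
    unfolding poly_altdef by (rule order_trans[OF sum_abs]) (simp add: abs_mult power_abs)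
  also have "\<dots> \<le> (\<Sum>i\<le>degree p. \<bar>coeff p i\<bar> * (1 + \<bar>x\<bar>) ^ k)"
  proof (intro sum_mono mult_left_mono)
    fix i assume "i \<in> {..degree p}"
    then have "\<bar>x\<bar> ^ i \<le> (1 + \<bar>x\<bar>) ^ i" "(1 + \<bar>x\<bar>) ^ i \<le> (1 + \<bar>x\<bar>) ^ k"
      using assms by (auto intro!: power_mono power_increasing)
    then show "\<bar>x\<bar> ^ i \<le> (1 + \<bar>x\<bar>) ^ k" by simp
  qed auto
  finally show ?thesis
    by (simp add: coeff_norm_def sum_distrib_right)
qed

text \<open>Only the j steps that multiply by P' can raise the degree, each by at most
  \<open>degree P - 1\<close>.\<close>

lemma degree_comp_coeff: "degree (comp_coeff P n j) \<le> j * (degree P - 1)"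
proof (induction n arbitrary: j)
  case (Suc n)
  note IH = Suc
  have 1: "degree (pderiv (comp_coeff P n j)) \<le> j * (degree P - 1)"
    using Suc[of j] by (simp add: degree_pderiv)
  show ?case
  proof (cases j)
    case (Suc i)
    have "degree (pderiv P * comp_coeff P n i) \<le> (degree P - 1) + i * (degree P - 1)"
      by (intro order_trans[OF degree_mult_le] add_mono IH) (simp add: degree_pderiv)
    with 1 Suc show ?thesis
      by (auto intro!: degree_add_le)
  qed (use 1 in auto)
qed simp

text \<open>Among n steps, j multiply by P' and the other n - j differentiate a polynomial of degree
  at most \<open>T * degree P\<close>; the binomial coefficient counts the orders and is reproduced
  by Pascal's rule. The fixed bound \<open>T\<close> keeps the cost of a differentiation constant
  during the induction.\<close>

lemma coeff_norm_comp_coeff: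
  assumes "n \<le> T"
  shows "coeff_norm (comp_coeff P n j) \<le>
    (n choose j) * real (T * degree P) ^ (n - j) * coeff_norm (pderiv P) ^ j"
  using assms
proof (induction n arbitrary: j)
  case 0
  then show ?case by (auto simp: coeff_norm_def)
next
  case (Suc n)
  let ?N = "real (T * degree P)" and ?K = "coeff_norm (pderiv P)"
  have 1: "coeff_norm (pderiv (comp_coeff P n j)) \<le> (n choose j) * ?N ^ (Suc n - j) * ?K ^ j"
  proof (cases "j \<le> n")
    case True
    have "degree (comp_coeff P n j) \<le> T * degree P"
      by (rule order_trans[OF degree_comp_coeff mult_le_mono]) (use True Suc.prems in auto)
    then have "coeff_norm (pderiv (comp_coeff P n j)) \<le> ?N * coeff_norm (comp_coeff P n j)"
      by (intro order_trans[OF coeff_norm_pderiv] mult_right_mono) (simp_all only: of_nat_le_iff coeff_norm_nonneg)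
    also have "\<dots> \<le> ?N * ((n choose j) * ?N ^ (n - j) * ?K ^ j)"
      using Suc by (intro mult_left_mono) auto
    finally show ?thesis
      using True by (simp add: Suc_diff_le mult_ac)
  qed (simp add: comp_coeff_eq_0)
  show ?case
  proof (cases j)
    case 0
    with 1 show ?thesis by simp
  next
    case j: (Suc i)
    have "coeff_norm (pderiv P * comp_coeff P n i) \<le> ?K * ((n choose i) * ?N ^ (n - i) * ?K ^ i)"
      by (intro order_trans[OF coeff_norm_mult] mult_left_mono Suc.IH) (use Suc.prems in auto)
    also have "\<dots> = (n choose i) * ?N ^ (Suc n - j) * ?K ^ j"
      using j by simp
    finally have "coeff_norm (comp_coeff P (Suc n) j) \<le>
        (n choose j) * ?N ^ (Suc n - j) * ?K ^ j + (n choose i) * ?N ^ (Suc n - j) * ?K ^ j"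
      using 1 j by (auto intro: order_trans[OF coeff_norm_add])
    then show ?thesis
      by (simp add: j algebra_simps)
  qed
qed

text \<open>For large |x| the leading term dominates, and for the remaining x the left side is
  bounded. This is what converts decay in P x into decay in x.\<close>

lemma poly_lower_bound:
  fixes P :: "real poly"
  assumes "degree P > 0"
  obtains L where "L \<ge> 1" "\<And>x. (1 + \<bar>x\<bar>) ^ degree P \<le> L * (1 + \<bar>poly P x\<bar>)"
proof -
  let ?N = "degree P"
  define a where "a = \<bar>lead_coeff P\<bar>"
  have a: "a > 0" using assms by (auto simp: a_def)
  define S where "S = coeff_norm P"
  \<comment> \<open>Beyond \<open>Y\<close>, the bound \<open>?y \<ge> 2\<close> gives
    \<open>?y \<le> 2 * \<bar>x\<bar>\<close>, and the second entry makes the lower-order terms,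
    multiplied by \<open>2 ^ ?N\<close>, at most half of \<open>a * ?y ^ ?N\<close>.
    \<open>L\<close> is the larger of the constants for the two ranges of x.\<close>
  define Y where "Y = max 2 (2 ^ (?N + 1) * S / a)"
  define L where "L = max (Y ^ ?N) (2 ^ (?N + 1) / a)"
  have Y: "Y \<ge> 1" by (simp add: Y_def)
  have L: "L \<ge> 1" using one_le_power[OF Y, of ?N] by (simp add: L_def)
  have "(1 + \<bar>x\<bar>) ^ ?N \<le> L * (1 + \<bar>poly P x\<bar>)" for x
  proof (cases "1 + \<bar>x\<bar> \<le> Y")
    case True
    then have "(1 + \<bar>x\<bar>) ^ ?N \<le> L"
      unfolding L_def by (intro max.coboundedI1 power_mono) auto
    also have "\<dots> \<le> L * (1 + \<bar>poly P x\<bar>)"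
      using L by (simp add: algebra_simps)
    finally show ?thesis .
  next
    case False
    let ?y = "1 + \<bar>x\<bar>"
    from False have y: "?y \<ge> 2" and "2 ^ (?N + 1) * S / a \<le> ?y"
      by (auto simp: Y_def)
    then have Sa: "2 ^ (?N + 1) * S \<le> a * ?y"
      using a by (simp add: field_simps)
    obtain k where k: "?N = Suc k" using assms gr0_implies_Suc by blast
    have "poly P x = lead_coeff P * x ^ ?N + (\<Sum>i\<le>k. coeff P i * x ^ i)"
      by (simp add: poly_altdef k)
    moreover have "\<bar>\<Sum>i\<le>k. coeff P i * x ^ i\<bar> \<le> S * ?y ^ k"
    proof -
      have "\<bar>\<Sum>i\<le>k. coeff P i * x ^ i\<bar> \<le> (\<Sum>i\<le>k. \<bar>coeff P i\<bar> * \<bar>x\<bar> ^ i)"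
        by (rule order_trans[OF sum_abs]) (simp add: abs_mult power_abs)
      also have "\<dots> \<le> (\<Sum>i\<le>k. \<bar>coeff P i\<bar> * ?y ^ k)"
      proof (intro sum_mono mult_left_mono)
        fix i assume "i \<in> {..k}"
        then have "\<bar>x\<bar> ^ i \<le> ?y ^ i" "?y ^ i \<le> ?y ^ k"
          by (auto intro!: power_mono power_increasing)
        then show "\<bar>x\<bar> ^ i \<le> ?y ^ k" by simp
      qed auto
      also have "\<dots> \<le> S * ?y ^ k"
        unfolding S_def coeff_norm_def k by (simp add: distrib_right flip: sum_distrib_right)
      finally show ?thesis .
    qed
    ultimately have "\<bar>lead_coeff P * x ^ ?N\<bar> \<le> \<bar>poly P x\<bar> + S * ?y ^ k"
      by linarith
    then have "a * \<bar>x\<bar> ^ ?N \<le> \<bar>poly P x\<bar> + S * ?y ^ k"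
      by (simp add: a_def abs_mult power_abs)
    moreover have "?y ^ ?N \<le> 2 ^ ?N * \<bar>x\<bar> ^ ?N"
      unfolding power_mult_distrib[symmetric] using y by (intro power_mono) auto
    then have "a * ?y ^ ?N \<le> 2 ^ ?N * (a * \<bar>x\<bar> ^ ?N)"
      using a by (simp add: mult_ac)
    ultimately have "a * ?y ^ ?N \<le> 2 ^ ?N * (\<bar>poly P x\<bar> + S * ?y ^ k)"
      by (meson mult_left_mono order_trans zero_le_numeral zero_le_power)
    moreover have "2 ^ (?N + 1) * S * ?y ^ k \<le> a * ?y * ?y ^ k"
      by (rule mult_right_mono[OF Sa]) simp
    ultimately have "a * ?y ^ ?N \<le> 2 ^ (?N + 1) * \<bar>poly P x\<bar>"
      by (simp add: k algebra_simps)
    then have "?y ^ ?N \<le> 2 ^ (?N + 1) / a * \<bar>poly P x\<bar>"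
      using a by (simp add: field_simps)
    also have "\<dots> \<le> L * (1 + \<bar>poly P x\<bar>)"
      using L a by (intro mult_mono) (auto simp: L_def)
    finally show ?thesis .
  qed
  with L show ?thesis using that by blast
qed

section \<open>Young conjugates of exponential functions\<close>

text \<open>The tangent inequality for exp at the critical point \<open>t = a * ln (s * a)\<close>,
  where equality holds.\<close>

lemma young_term_le:
  fixes a s t :: real
  assumes "a > 0" "s > 0"
  shows "s * t - exp (t / a) \<le> s * a * ln (s * a) - s * a"
proof -
  have "1 + (t / a - ln (s * a)) \<le> exp (t / a - ln (s * a))"
    by (rule exp_ge_add_one_self)
  also have "\<dots> = exp (t / a) / (s * a)"
    using assms by (simp add: exp_diff)
  finally have "(1 + (t / a - ln (s * a))) * (s * a) \<le> exp (t / a)"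
    using assms by (simp only: pos_le_divide_eq mult_pos_pos)
  moreover have "(1 + (t / a - ln (s * a))) * (s * a) = s * a + s * t - s * a * ln (s * a)"
    using assms by (simp add: field_simps)
  ultimately show ?thesis by linarith
qed

lemma young_conj_le:
  fixes a s :: real
  assumes "a > 0" "s > 0"
  shows "young_conj (\<lambda>t. exp (t / a)) s \<le> s * a * ln (s * a)"
  unfolding young_conj_def
proof (rule cSUP_least)
  fix t
  show "s * t - exp (t / a) \<le> s * a * ln (s * a)"
    using young_term_le[OF assms, of t] mult_pos_pos[OF assms(2,1)] by linarith
qed auto

text \<open>The supremum is a real one, so an element lies below it only once the set is known to be
  bounded above; \<open>s = 0\<close> is separate because the logarithmic bound requires
  \<open>s > 0\<close>.\<close>

lemma young_conj_ge:
  fixes a s t :: real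
  assumes "a > 0" "s \<ge> 0" "t \<ge> 0"
  shows "s * t - exp (t / a) \<le> young_conj (\<lambda>t. exp (t / a)) s"
proof -
  have "bdd_above ((\<lambda>t. s * t - exp (t / a)) ` {0..})"
  proof (cases "s = 0")
    case True
    then show ?thesis by (intro bdd_aboveI2[of _ _ 0]) auto
  next
    case False
    then show ?thesis
      using assms by (intro bdd_aboveI2[of _ _ "s * a * ln (s * a) - s * a"] young_term_le) auto
  qed
  then show ?thesis
    unfolding young_conj_def using assms by (intro cSUP_upper) auto
qed

text \<open>The value \<open>t = a ln (T + 1)\<close> in the supremum is close enough to the maximiser
  and avoids a case distinction at \<open>T = 0\<close>.\<close>

lemma young_weight_le:
  fixes a l :: real and T :: nat
  assumes "a > 0" "l > 0"
  shows "- l * young_conj (\<lambda>t. exp (t / a)) (T / l) \<le> l * (real T + 1) - a * T * ln (real T + 1)"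
proof -
  let ?t = "a * ln (real T + 1)"
  have "T / l * ?t - exp (?t / a) \<le> young_conj (\<lambda>t. exp (t / a)) (T / l)"
    by (intro young_conj_ge) (use assms in auto)
  moreover have "exp (?t / a) = real T + 1"
    using assms by simp
  ultimately have "T / l * ?t - (real T + 1) \<le> young_conj (\<lambda>t. exp (t / a)) (T / l)"
    by simp
  from mult_left_mono[OF this, of l] show ?thesis
    using assms by (simp add: algebra_simps)
qed

text \<open>Once \<open>ln (real T + 1)\<close> reaches \<open>a / b\<close>, the negative term
  wins; before that, T is below \<open>exp (a / b)\<close>. This lets a factor decaying like
  \<open>(T + 1) powr (- b * T)\<close> absorb any geometric growth.\<close>

lemma linear_minus_entropy_bounded:
  fixes a b c :: real
  assumes "b > 0"
  obtains B where "\<And>T::nat. c + a * T - b * T * ln (real T + 1) \<le> B"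
proof (rule that[of "c + \<bar>a\<bar> * exp (a / b)"])
  fix T :: nat
  show "c + a * T - b * T * ln (real T + 1) \<le> c + \<bar>a\<bar> * exp (a / b)"
  proof (cases "ln (real T + 1) \<ge> a / b")
    case True
    then have "a * T \<le> b * ln (real T + 1) * T"
      using assms by (intro mult_right_mono) (auto simp: field_simps)
    then have "a * T \<le> b * T * ln (real T + 1)"
      by (simp add: mult_ac)
    moreover have "0 \<le> \<bar>a\<bar> * exp (a / b)" by simp
    ultimately show ?thesis by linarith
  next
    case False
    then have "exp (ln (real T + 1)) < exp (a / b)"
      by (subst exp_less_cancel_iff) (simp add: add.commute)
    then have "real T < exp (a / b)"
      by simp
    then have "a * T \<le> \<bar>a\<bar> * exp (a / b)"
      by (intro mult_mono) auto
    moreover have "0 \<le> b * T * ln (real T + 1)"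
      using assms by simp
    ultimately show ?thesis by linarith
  qed
qed

section \<open>Seminorms and continuity\<close>

lemma p_seminorm_le_iff:
  "p_seminorm \<omega> l f \<le> c \<longleftrightarrow>
    (\<forall>x n q. ennreal ((1 + \<bar>x\<bar>) ^ q * norm (nth_vderiv n f x) *
                 exp (- l * young_conj (phi \<omega>) (real (n + q) / l))) \<le> c)"
  unfolding p_seminorm_def by (auto simp: SUP_le_iff)

lemma p_seminorm_term_le:
  "ennreal ((1 + \<bar>x\<bar>) ^ q * norm (nth_vderiv n f x) *
      exp (- l * young_conj (phi \<omega>) (real (n + q) / l))) \<le> p_seminorm \<omega> l f"
  using p_seminorm_le_iff[of \<omega> l f "p_seminorm \<omega> l f"] by simp

lemma p_seminorm_lincomb:
  assumes "smooth f" "smooth g"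
  shows "p_seminorm \<omega> l (\<lambda>x. a * f x + b * g x) \<le>
    ennreal (norm a) * p_seminorm \<omega> l f + ennreal (norm b) * p_seminorm \<omega> l g"
  unfolding p_seminorm_le_iff
proof (intro allI)
  fix x n q
  let ?w = "exp (- l * young_conj (phi \<omega>) (real (n + q) / l))"
  let ?s = "\<lambda>f. (1 + \<bar>x\<bar>) ^ q * norm (nth_vderiv n f x) * ?w"
  have "norm (nth_vderiv n (\<lambda>x. a * f x + b * g x) x) \<le>
      norm a * norm (nth_vderiv n f x) + norm b * norm (nth_vderiv n g x)"
    unfolding nth_vderiv_lincomb[OF assms] by (metis norm_mult norm_triangle_ineq)
  then have "?s (\<lambda>x. a * f x + b * g x) \<le>
      (1 + \<bar>x\<bar>) ^ q * (norm a * norm (nth_vderiv n f x) + norm b * norm (nth_vderiv n g x)) * ?w"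
    by (intro mult_left_mono mult_right_mono) auto
  also have "\<dots> = norm a * ?s f + norm b * ?s g"
    by (simp add: algebra_simps)
  finally have "ennreal (?s (\<lambda>x. a * f x + b * g x)) \<le> ennreal (norm a * ?s f + norm b * ?s g)"
    by (rule ennreal_leI)
  also have "\<dots> = ennreal (norm a) * ennreal (?s f) + ennreal (norm b) * ennreal (?s g)"
    by (simp add: ennreal_mult)
  also have "\<dots> \<le> ennreal (norm a) * p_seminorm \<omega> l f + ennreal (norm b) * p_seminorm \<omega> l g"
    by (intro add_mono mult_left_mono p_seminorm_term_le) auto
  finally show "ennreal (?s (\<lambda>x. a * f x + b * g x)) \<le> \<dots>" .
qed

lemma S_space_lincomb:
  assumes "f \<in> S_space \<omega>" "g \<in> S_space \<omega>"
  shows "(\<lambda>x. a * f x + b * g x) \<in> S_space \<omega>"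
  unfolding S_space_def mem_Collect_eq
proof (intro conjI allI impI)
  show "smooth (\<lambda>x. a * f x + b * g x)"
    using assms by (intro smooth_lincomb) (auto simp: S_space_def)
  fix l :: real assume "l > 0"
  then have "ennreal (norm a) * p_seminorm \<omega> l f + ennreal (norm b) * p_seminorm \<omega> l g < \<infinity>"
    using assms by (auto simp: S_space_def ennreal_mult_less_top)
  moreover have "p_seminorm \<omega> l (\<lambda>x. a * f x + b * g x) \<le>
      ennreal (norm a) * p_seminorm \<omega> l f + ennreal (norm b) * p_seminorm \<omega> l g"
    using assms by (intro p_seminorm_lincomb) (auto simp: S_space_def)
  ultimately show "p_seminorm \<omega> l (\<lambda>x. a * f x + b * g x) < \<infinity>"
    by (rule le_less_trans[rotated])
qed

lemma S_space_diff:
  assumes "f \<in> S_space \<omega>" "g \<in> S_space \<omega>"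
  shows "(\<lambda>x. f x - g x) \<in> S_space \<omega>"
  using S_space_lincomb[OF assms, of 1 "-1"] by simp

lemma p_seminorm_triangle:
  assumes "f \<in> S_space \<omega>" "g \<in> S_space \<omega>" "h \<in> S_space \<omega>"
  shows "p_seminorm \<omega> l (\<lambda>x. f x - h x) \<le>
    p_seminorm \<omega> l (\<lambda>x. f x - g x) + p_seminorm \<omega> l (\<lambda>x. g x - h x)"
  using p_seminorm_lincomb[of "\<lambda>x. f x - g x" "\<lambda>x. g x - h x" \<omega> l 1 1]
    S_space_diff[OF assms(1,2)] S_space_diff[OF assms(2,3)]
  by (simp add: S_space_def)

lemma p_seminorm_zero [simp]: "p_seminorm \<omega> l (\<lambda>x. 0) = 0"
proof -
  have "nth_vderiv n (\<lambda>x. 0) = (\<lambda>x. 0)" for n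
    using nth_vderiv_tower[of "\<lambda>n x. 0"] by auto
  then show ?thesis
    unfolding p_seminorm_def by simp
qed

lemma topspace_lc_topology_S_space:
  "topspace (lc_topology (S_space \<omega>) (S_seminorms \<omega>)) = S_space \<omega>"
proof -
  let ?B = "{{g \<in> S_space \<omega>. p (\<lambda>x. g x - f x) < ennreal r} |p f r.
      p \<in> S_seminorms \<omega> \<and> f \<in> S_space \<omega> \<and> r > 0}"
  have "f \<in> \<Union>?B" if f: "f \<in> S_space \<omega>" for f
  proof (rule UnionI)
    have "p_seminorm \<omega> 1 \<in> S_seminorms \<omega>" "(0::real) < 1"
      by (auto simp: S_seminorms_def intro: exI[of _ 1])
    with f show "{g \<in> S_space \<omega>. p_seminorm \<omega> 1 (\<lambda>x. g x - f x) < ennreal 1} \<in> ?B"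
      by blast
    show "f \<in> {g \<in> S_space \<omega>. p_seminorm \<omega> 1 (\<lambda>x. g x - f x) < ennreal 1}"
      using f by simp
  qed
  then show ?thesis
    unfolding lc_topology_def topology_generated_by_topspace by auto
qed

text \<open>It suffices to test preimages of subbasic balls. Around a point g of such a preimage, a
  ball of radius \<open>(r - s) / B\<close>, with s the distance of T g from the centre, stays
  inside by the triangle inequality.\<close>

lemma cont_lin_op_S_space:
  assumes smooth: "\<And>f. smooth f \<Longrightarrow> smooth (T f)"
    and linear: "\<And>f g a b. T (\<lambda>x. a * f x + b * g x) = (\<lambda>x. a * T f x + b * T g x)"
    and bound: "\<And>l. l > 0 \<Longrightarrow> \<exists>k>0. \<exists>B>0. \<forall>f. smooth f \<longrightarrow> p_seminorm \<sigma> l (T f) \<le> ennreal B * p_seminorm \<omega> k f"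
  shows "cont_lin_op (S_space \<omega>) (S_seminorms \<omega>) (S_space \<sigma>) (S_seminorms \<sigma>) T"
proof -
  have T: "T f \<in> S_space \<sigma>" if f: "f \<in> S_space \<omega>" for f
    unfolding S_space_def mem_Collect_eq
  proof (intro conjI allI impI)
    show "smooth (T f)" using f smooth by (auto simp: S_space_def)
    fix l :: real assume "l > 0"
    then obtain k B where "k > 0" "p_seminorm \<sigma> l (T f) \<le> ennreal B * p_seminorm \<omega> k f"
      using bound[of l] f unfolding S_space_def by blast
    moreover have "ennreal B * p_seminorm \<omega> k f < \<infinity>"
      using f \<open>k > 0\<close> by (auto simp: S_space_def ennreal_mult_less_top)
    ultimately show "p_seminorm \<sigma> l (T f) < \<infinity>"
      by (rule_tac le_less_trans)
  qed
  have T_diff: "T (\<lambda>x. g x - f x) = (\<lambda>x. T g x - T f x)" for f g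
    using linear[of 1 g "-1" f] by simp
  let ?X = "lc_topology (S_space \<omega>) (S_seminorms \<omega>)"
  have "openin ?X (T -` {g \<in> S_space \<sigma>. p_seminorm \<sigma> l (\<lambda>x. g x - f0 x) < ennreal r} \<inter> S_space \<omega>)"
    (is "openin ?X ?V")
    if l: "l > 0" and f0: "f0 \<in> S_space \<sigma>" and "r > 0" for l f0 r
  proof (subst openin_subopen, intro ballI)
    fix g assume "g \<in> ?V"
    then have g: "g \<in> S_space \<omega>" and lt: "p_seminorm \<sigma> l (\<lambda>x. T g x - f0 x) < ennreal r"
      by auto
    obtain k B where k: "k > 0" and B: "B > 0"
      and kB: "\<And>f. smooth f \<Longrightarrow> p_seminorm \<sigma> l (T f) \<le> ennreal B * p_seminorm \<omega> k f"
      using bound[OF l] by auto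
    \<comment> \<open>The distance is below \<open>ennreal r\<close>, hence finite; subtraction and
      strict cancellation of \<open>s\<close> become legitimate.\<close>
    obtain s where s: "s \<ge> 0" "p_seminorm \<sigma> l (\<lambda>x. T g x - f0 x) = ennreal s"
      using lt by (metis ennreal_cases ennreal_less_top less_irrefl order.strict_trans)
    with lt have sr: "s < r" by (simp add: ennreal_less_iff)
    let ?U = "{h \<in> S_space \<omega>. p_seminorm \<omega> k (\<lambda>x. h x - g x) < ennreal ((r - s) / B)}"
    have "openin ?X ?U"
      unfolding lc_topology_def
    proof (rule topology_generated_by_Basis)
      have "p_seminorm \<omega> k \<in> S_seminorms \<omega>" "(r - s) / B > 0"
        using k B sr by (auto simp: S_seminorms_def)
      with g show "?U \<in> {{g \<in> S_space \<omega>. p (\<lambda>x. g x - f x) < ennreal r} |p f r.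
          p \<in> S_seminorms \<omega> \<and> f \<in> S_space \<omega> \<and> r > 0}"
        by blast
    qed
    moreover have "g \<in> ?U"
      using g sr B by simp
    moreover have "?U \<subseteq> ?V"
    proof
      fix h assume "h \<in> ?U"
      then have h: "h \<in> S_space \<omega>" and lt: "p_seminorm \<omega> k (\<lambda>x. h x - g x) < ennreal ((r - s) / B)"
        by auto
      have "p_seminorm \<sigma> l (\<lambda>x. T h x - T g x) \<le> ennreal B * p_seminorm \<omega> k (\<lambda>x. h x - g x)"
        using kB[of "\<lambda>x. h x - g x"] S_space_diff[OF h g] by (simp add: T_diff S_space_def)
      also have "\<dots> < ennreal B * ennreal ((r - s) / B)"
        using lt B by (intro ennreal_mult_strict_left_mono) auto
      also have "\<dots> = ennreal (r - s)"
        using B sr by (subst ennreal_mult[symmetric]) auto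
      finally have "p_seminorm \<sigma> l (\<lambda>x. T h x - T g x) < ennreal (r - s)" .
      then have "p_seminorm \<sigma> l (\<lambda>x. T h x - T g x) + ennreal s < ennreal (r - s) + ennreal s"
        by (subst (1 2) add.commute) (simp add: ennreal_add_left_cancel_less)
      also have "\<dots> = ennreal r"
        using s sr by (subst ennreal_plus[symmetric]) auto
      finally have "p_seminorm \<sigma> l (\<lambda>x. T h x - f0 x) < ennreal r"
        using p_seminorm_triangle[OF T[OF h] T[OF g] f0, of l] unfolding s(2)
        by (rule le_less_trans[rotated])
      with h T show "h \<in> ?V" by simp
    qed
    ultimately show "\<exists>U. openin ?X U \<and> g \<in> U \<and> U \<subseteq> ?V"
      by blast
  qed
  then have "continuous_map ?X (lc_topology (S_space \<sigma>) (S_seminorms \<sigma>)) T"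
    unfolding lc_topology_def[of "S_space \<sigma>"] continuous_on_generated_topo_iff
      topspace_lc_topology_S_space
    using T topspace_lc_topology_S_space[of \<sigma>]
    unfolding lc_topology_def[of "S_space \<sigma>"] topology_generated_by_topspace
    by (auto simp: S_seminorms_def)
  with T linear show ?thesis
    unfolding cont_lin_op_def by blast
qed

section \<open>Composition with a polynomial\<close>

text \<open>The exponents of \<open>T + 1\<close> add up to at most \<open>d - (d / N) T\<close>, so that any
  geometric factor is absorbed.\<close>

lemma comp_factor_bounded:
  fixes d l K L :: real and N :: nat
  assumes "d \<ge> 1" "l > 0" "N > 0" "K \<ge> 1" "L \<ge> 1"
  obtains B where "B > 0" "\<And>n q j p. j \<le> n \<Longrightarrow> p = (q + j * (N - 1)) div N + 1 \<Longrightarrow>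
      2 ^ n * (real ((n + q) * N) ^ (n - j) * K ^ j * L ^ p * exp (real (j + p) * d * ln (real (j + p) * d)) *
        exp (l * (real (n + q) + 1) - 2 * d * (n + q) * ln (real (n + q) + 1))) \<le> B"
proof -
  \<comment> \<open>With \<open>u\<close>, the integer division in \<open>p\<close> turns into the
    real bound \<open>p \<le> q * u + j * (1 - u) + 1\<close>.\<close>
  define u where "u = 1 / real N"
  have u: "0 < u" "u \<le> 1"
    using assms by (auto simp: u_def)
  \<comment> \<open>The constant part and the coefficient of T that remain in the exponent once all
    factors have been written as exponentials.\<close>
  let ?c = "ln L + 2 * d * ln (2 * d) + l"
  let ?a = "ln 2 + ln N + ln K + ln L + 2 * d * ln (2 * d) + l + d"
  obtain B where B: "\<And>T::nat. ?c + ?a * T - (d * u) * T * ln (real T + 1) \<le> B"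
    using linear_minus_entropy_bounded[of "d * u" ?c ?a] assms u by auto
  have "2 ^ n * (real ((n + q) * N) ^ (n - j) * K ^ j * L ^ p * exp (real (j + p) * d * ln (real (j + p) * d)) *
        exp (l * (real (n + q) + 1) - 2 * d * (n + q) * ln (real (n + q) + 1))) \<le> exp B"
    if j: "j \<le> n" and p: "p = (q + j * (N - 1)) div N + 1" for n q j p
  proof -
    define T where "T = n + q"
    define e where "e = ln (real T + 1)"
    define s where "s = j + p"
    have e: "0 \<le> e" "e \<le> T"
      using ln_le_minus_one[of "real T + 1"] by (auto simp: e_def)
    have "real p \<le> real (q + j * (N - 1)) / N + 1"
      unfolding p of_nat_add using of_nat_div_le_of_nat[of "q + j * (N - 1)" N, where ?'a = real] by simp
    also have "\<dots> = q * u + j * (1 - u) + 1"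
      using assms by (simp add: u_def of_nat_diff field_simps)
    finally have p_le: "p \<le> q * u + j * (1 - u) + 1" .
    moreover have "q * u \<le> q" "j * (1 - u) \<le> j"
      using u by (simp_all add: mult_left_le)
    ultimately have p_le': "real p \<le> T + 1"
      using j by (simp add: T_def)
    then have s_le': "real s \<le> 2 * (real T + 1)"
      using j by (simp add: s_def T_def)
    have s_pos: "real s > 0"
      by (simp add: s_def p)
    have "0 < s * d" "s * d \<le> 2 * d * (real T + 1)"
      using mult_right_mono[OF s_le', of d] s_pos assms by (simp_all add: mult_ac)
    then have "ln (s * d) \<le> ln (2 * d * (real T + 1))"
      by (subst ln_le_cancel_iff) linarith+
    also have "\<dots> = ln (2 * d) + e"
      using assms by (subst ln_mult) (auto simp: e_def)
    finally have ln_sd: "ln (s * d) \<le> ln (2 * d) + e" .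
    have ln_2d: "0 \<le> ln (2 * d)"
      using assms by simp
    have "s * d * ln (s * d) \<le> s * d * ln (2 * d) + s * d * e"
      using mult_left_mono[OF ln_sd, of "s * d"] s_pos assms by (simp add: distrib_left)
    moreover have "s * d * ln (2 * d) \<le> 2 * (real T + 1) * (d * ln (2 * d))"
      using mult_right_mono[OF s_le', of "d * ln (2 * d)"] ln_2d assms by (simp add: mult_ac)
    ultimately have E1: "s * d * ln (s * d) \<le> 2 * (real T + 1) * (d * ln (2 * d)) + s * d * e"
      by linarith
    \<comment> \<open>After inserting the bound on \<open>p\<close>, the difference of the two sides
      of the inequality for the coefficient of e is exactly this nonpositive product minus the
      nonnegative term \<open>2 * d * q * (1 - u)\<close>.\<close>
    have "(real n - j) * (1 - d * (2 - u)) \<le> 0"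
    proof (rule mult_nonneg_nonpos)
      have "1 * 1 \<le> d * (2 - u)" using assms u by (intro mult_mono) auto
      then show "1 - d * (2 - u) \<le> 0" by simp
    qed (use j in auto)
    moreover have "0 \<le> 2 * d * q * (1 - u)"
      using assms u by simp
    moreover have "s * d \<le> (j + q * u + j * (1 - u) + 1) * d"
      using p_le assms by (intro mult_right_mono) (auto simp: s_def)
    ultimately have "(real n - j) + s * d - 2 * d * T \<le> d - d * u * T"
      unfolding T_def by (simp add: algebra_simps)
    then have "((real n - j) + s * d - 2 * d * T) * e \<le> (d - d * u * T) * e"
      using e by (intro mult_right_mono) auto
    \<comment> \<open>The surplus \<open>d * ln (T + 1)\<close> caused by rounding \<open>p\<close>
      up is moved to the linear terms.\<close>
    moreover have "d * e \<le> d * T"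
      using e assms by simp
    ultimately have E2: "(real n - j) * e + s * d * e - 2 * d * T * e \<le> d * T - d * u * T * e"
      by (simp add: algebra_simps)
    have E3: "n * ln 2 \<le> T * ln 2" "(real n - j) * ln N \<le> T * ln N" "j * ln K \<le> T * ln K"
        "p * ln L \<le> (real T + 1) * ln L"
      using assms j p_le' by (auto intro!: mult_right_mono simp: T_def)
    have "real (T * N) ^ (n - j) \<le> (exp (ln N + e)) ^ (n - j)"
      using assms by (intro power_mono) (auto simp: exp_add e_def)
    also have "\<dots> = exp ((real n - j) * (ln N + e))"
      using j by (simp flip: exp_of_nat_mult add: of_nat_diff)
    finally have "2 ^ n * (real (T * N) ^ (n - j) * K ^ j * L ^ p * exp (s * d * ln (s * d)) *
        exp (l * (real T + 1) - 2 * d * T * e))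
      \<le> exp (n * ln 2) * (exp ((real n - j) * (ln N + e)) * exp (j * ln K) * exp (p * ln L) *
          exp (s * d * ln (s * d)) * exp (l * (real T + 1) - 2 * d * T * e))"
      using assms by (intro mult_mono mult_nonneg_nonneg) (auto simp: exp_of_nat_mult)
    also have "\<dots> = exp (n * ln 2 + ((real n - j) * (ln N + e) + j * ln K + p * ln L +
          s * d * ln (s * d) + (l * (real T + 1) - 2 * d * T * e)))"
      by (simp only: exp_add)
    also have "\<dots> \<le> exp B"
    proof -
      have "n * ln 2 + ((real n - j) * (ln N + e) + j * ln K + p * ln L +
          s * d * ln (s * d) + (l * (real T + 1) - 2 * d * T * e)) \<le>
          T * ln 2 + T * ln N + T * ln K + (real T + 1) * ln L + 2 * (real T + 1) * (d * ln (2 * d))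
          + l * (real T + 1) + d * T - d * u * T * e"
        using E1 E2 E3 unfolding distrib_left by linarith
      also have "\<dots> = ?c + ?a * T - (d * u) * T * ln (real T + 1)"
        by (simp add: e_def algebra_simps)
      also have "\<dots> \<le> B" by (rule B)
      finally show ?thesis by simp
    qed
    finally show ?thesis
      by (simp only: T_def s_def e_def)
  qed
  then show ?thesis
    by (intro that[of "exp B"]) auto
qed

text \<open>The source seminorm has index 1 whatever \<open>l\<close> is: \<open>l\<close> enters
  the estimate of the target weight only through \<open>exp (l * (T + 1))\<close> with T = n + q, a
  geometric factor that the superexponential margin absorbs.\<close>

lemma p_seminorm_comp_poly:
  fixes d l :: real
  assumes d: "d \<ge> 1" and \<omega>: "phi \<omega> = (\<lambda>t. exp (t / d))" and \<sigma>: "phi \<sigma> = (\<lambda>t. exp (t / (2 * d)))"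
    and P: "degree P > 0" and l: "l > 0"
  obtains B where "B > 0"
    "\<And>f. smooth f \<Longrightarrow> p_seminorm \<sigma> l (f \<circ> poly P) \<le> ennreal B * p_seminorm \<omega> 1 f"
proof -
  let ?N = "degree P"
  define K where "K = coeff_norm (pderiv P) + 1"
  obtain L where L: "L \<ge> 1" "\<And>x. (1 + \<bar>x\<bar>) ^ ?N \<le> L * (1 + \<bar>poly P x\<bar>)"
    using poly_lower_bound[OF P] by blast
  have K: "K \<ge> 1" by (simp add: K_def)
  obtain B where "B > 0" and B: "\<And>n q j p. j \<le> n \<Longrightarrow> p = (q + j * (?N - 1)) div ?N + 1 \<Longrightarrow>
      2 ^ n * (real ((n + q) * ?N) ^ (n - j) * K ^ j * L ^ p * exp (real (j + p) * d * ln (real (j + p) * d)) *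
        exp (l * (real (n + q) + 1) - 2 * d * (n + q) * ln (real (n + q) + 1))) \<le> B"
    using comp_factor_bounded[OF d l P K L(1)] by blast
  have "p_seminorm \<sigma> l (f \<circ> poly P) \<le> ennreal B * p_seminorm \<omega> 1 f" if f: "smooth f" for f
  \<comment> \<open>If the seminorm of f is infinite, so is the right-hand side, because
    \<open>B > 0\<close>. Otherwise its finite value \<open>M\<close> gives pointwise bounds on the
    derivatives of f.\<close>
  proof (cases "p_seminorm \<omega> 1 f" rule: ennreal_cases)
    case top
    then show ?thesis using \<open>B > 0\<close> by (simp add: ennreal_mult_top)
  next
    case (real M)
    have M: "(1 + \<bar>y\<bar>) ^ p * norm (nth_vderiv j f y) \<le> M * exp (real (j + p) * d * ln (real (j + p) * d))"
      if "p > 0" for y p j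
    proof -
      let ?Y = "young_conj (phi \<omega>) (real (j + p))"
      have "ennreal ((1 + \<bar>y\<bar>) ^ p * norm (nth_vderiv j f y) * exp (- ?Y)) \<le> ennreal M"
        using p_seminorm_term_le[of y p j f 1 \<omega>] real by simp
      then have "(1 + \<bar>y\<bar>) ^ p * norm (nth_vderiv j f y) * exp (- ?Y) \<le> M"
        using real by (subst (asm) ennreal_le_iff) auto
      then have "(1 + \<bar>y\<bar>) ^ p * norm (nth_vderiv j f y) \<le> M * exp ?Y"
        by (simp add: exp_minus field_simps)
      also have "?Y \<le> real (j + p) * d * ln (real (j + p) * d)"
        unfolding \<omega> using young_conj_le[of d "real (j + p)"] d that by simp
      finally show ?thesis using real by (simp add: mult_left_mono)
    qed
    show ?thesis
      unfolding p_seminorm_le_iff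
    proof (intro allI)
      fix x n q
      let ?w = "exp (- l * young_conj (phi \<sigma>) (real (n + q) / l))"
      have w: "?w \<le> exp (l * (real (n + q) + 1) - 2 * d * (n + q) * ln (real (n + q) + 1))"
        unfolding \<sigma> using young_weight_le[of "2 * d" l "n + q"] d l by (simp add: add_ac)
      \<comment> \<open>The share \<open>2 ^ n\<close> is set aside in each term because the
        binomial coefficients sum to \<open>2 ^ n\<close> over j.\<close>
      have term_le: "(1 + \<bar>x\<bar>) ^ q * norm (of_real (poly (comp_coeff P n j) x) * nth_vderiv j f (poly P x)) * ?w
          \<le> real (n choose j) * (B * M / 2 ^ n)" if j: "j \<le> n" for j
      proof -
        let ?y = "1 + \<bar>x\<bar>" and ?Y = "1 + \<bar>poly P x\<bar>"
        \<comment> \<open>The powers of 1 + |x| to be compensated are q from the seminorm and j (N -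
          1) from the coefficient. \<open>p\<close> is chosen with
          \<open>q + j * (?N - 1) \<le> ?N * p\<close>, so that p powers of 1 + |P x| suffice; the
          added 1 rounds up and also ensures \<open>p > 0\<close>, as \<open>M\<close>
          requires.\<close>
        define p where "p = (q + j * (?N - 1)) div ?N + 1"
        let ?C = "real ((n + q) * ?N) ^ (n - j) * K ^ j"
        let ?E = "exp (real (j + p) * d * ln (real (j + p) * d))"
        let ?v = "norm (nth_vderiv j f (poly P x))"
        have "\<bar>poly (comp_coeff P n j) x\<bar> \<le> coeff_norm (comp_coeff P n j) * ?y ^ (j * (?N - 1))"
          by (rule abs_poly_le[OF degree_comp_coeff])
        also have "coeff_norm (comp_coeff P n j) \<le>
            (n choose j) * real ((n + q) * ?N) ^ (n - j) * coeff_norm (pderiv P) ^ j"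
          by (rule coeff_norm_comp_coeff) simp
        also have "\<dots> \<le> (n choose j) * real ((n + q) * ?N) ^ (n - j) * K ^ j"
          by (intro mult_left_mono power_mono) (auto simp: K_def)
        finally have c: "\<bar>poly (comp_coeff P n j) x\<bar> \<le> (n choose j) * ?C * ?y ^ (j * (?N - 1))"
          by (simp add: mult_right_mono mult.assoc)
        have "q + j * (?N - 1) \<le> ?N * p"
          using P by (simp add: p_def) (metis add.commute div_mult_mod_eq less_imp_le mod_less_divisor mult.commute nat_add_left_cancel_le)
        then have "?y ^ (q + j * (?N - 1)) \<le> (?y ^ ?N) ^ p"
          unfolding power_mult[symmetric] by (intro power_increasing) auto
        also have "\<dots> \<le> (L * ?Y) ^ p"
          by (intro power_mono L) auto
        finally have y: "?y ^ q * ?y ^ (j * (?N - 1)) \<le> L ^ p * ?Y ^ p"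
          by (simp add: power_add power_mult_distrib)
        have "?y ^ q * norm (of_real (poly (comp_coeff P n j) x) * nth_vderiv j f (poly P x)) * ?w
            = ?y ^ q * \<bar>poly (comp_coeff P n j) x\<bar> * ?v * ?w"
          by (simp add: norm_mult)
        also have "\<dots> \<le> ?y ^ q * ((n choose j) * ?C * ?y ^ (j * (?N - 1))) * ?v * ?w"
          by (intro mult_right_mono mult_left_mono c) auto
        also have "\<dots> = (n choose j) * ?C * (?y ^ q * ?y ^ (j * (?N - 1))) * ?v * ?w"
          by (simp only: mult_ac)
        also have "\<dots> \<le> (n choose j) * ?C * (L ^ p * ?Y ^ p) * ?v * ?w"
          using K by (intro mult_right_mono mult_left_mono y) auto
        also have "\<dots> = (n choose j) * ?C * L ^ p * (?Y ^ p * ?v) * ?w"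
          by (simp only: mult_ac)
        also have "\<dots> \<le> (n choose j) * ?C * L ^ p * (M * ?E) *
            exp (l * (real (n + q) + 1) - 2 * d * (n + q) * ln (real (n + q) + 1))"
        proof (intro mult_mono[OF mult_left_mono w])
          show "?Y ^ p * ?v \<le> M * ?E"
            by (rule M) (simp add: p_def)
        qed (use K L(1) real in auto)
        also have "\<dots> = (n choose j) * M / 2 ^ n * (2 ^ n * (?C * L ^ p * ?E *
            exp (l * (real (n + q) + 1) - 2 * d * (n + q) * ln (real (n + q) + 1))))"
          by simp
        also have "\<dots> \<le> (n choose j) * M / 2 ^ n * B"
          using real by (intro mult_left_mono B j p_def) auto
        finally show ?thesis by (simp add: mult_ac)
      qed
      have "(1 + \<bar>x\<bar>) ^ q * norm (nth_vderiv n (f \<circ> poly P) x) * ?w \<le>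
          (1 + \<bar>x\<bar>) ^ q * (\<Sum>j\<le>n. norm (of_real (poly (comp_coeff P n j) x) * nth_vderiv j f (poly P x))) * ?w"
        unfolding nth_vderiv_comp_poly[OF f]
        by (intro mult_right_mono mult_left_mono norm_sum) auto
      also have "\<dots> \<le> (\<Sum>j\<le>n. real (n choose j) * (B * M / 2 ^ n))"
        unfolding sum_distrib_left sum_distrib_right by (intro sum_mono term_le) auto
      also have "\<dots> = real (\<Sum>j\<le>n. n choose j) * (B * M / 2 ^ n)"
        by (simp only: sum_distrib_right of_nat_sum)
      also have "\<dots> = B * M"
        by (simp add: choose_row_sum)
      finally have "ennreal ((1 + \<bar>x\<bar>) ^ q * norm (nth_vderiv n (f \<circ> poly P) x) * ?w) \<le> ennreal (B * M)"
        by (rule ennreal_leI)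
      then show "ennreal ((1 + \<bar>x\<bar>) ^ q * norm (nth_vderiv n (f \<circ> poly P) x) * ?w) \<le>
          ennreal B * p_seminorm \<omega> 1 f"
        using real \<open>B > 0\<close> by (simp add: ennreal_mult)
    qed
  qed
  with \<open>B > 0\<close> show ?thesis
    by (rule that)
qed

section \<open>Polynomial iterates and their multiplier at a fixed point\<close>

definition poly_iter :: "real poly \<Rightarrow> nat \<Rightarrow> real poly" where
  "poly_iter \<psi> m = (pcompose \<psi> ^^ m) [:0, 1:]"

lemma poly_poly_iter: "poly (poly_iter \<psi> m) = poly \<psi> ^^ m"
  by (induction m) (auto simp: poly_iter_def poly_pcompose fun_eq_iff)

lemma degree_poly_iter: "degree (poly_iter \<psi> m) = degree \<psi> ^ m"
  by (induction m) (auto simp: poly_iter_def degree_pcompose)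

lemma poly_iter_fixpoint:
  assumes "poly \<psi> x = x"
  shows "poly (poly_iter \<psi> m) x = x"
  using assms by (induction m) (auto simp: poly_iter_def poly_pcompose)

lemma poly_pderiv_poly_iter:
  assumes "poly \<psi> x = x"
  shows "poly (pderiv (poly_iter \<psi> m)) x = poly (pderiv \<psi>) x ^ m"
proof (induction m)
  case (Suc m)
  then show ?case
    using poly_iter_fixpoint[OF assms, of m]
    by (simp add: poly_iter_def pderiv_pcompose poly_pcompose)
qed (simp add: poly_iter_def pderiv_pCons)

section \<open>Test functions at a repelling fixed point\<close>

text \<open>Real derivatives of the restriction of an entire function are restrictions of its
  complex derivatives, which makes Cauchy estimates available.\<close>

lemma
  assumes "F holomorphic_on UNIV"
  shows smooth_holomorphic: "smooth (\<lambda>x. F (of_real x))"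
    and nth_vderiv_holomorphic: "nth_vderiv n (\<lambda>x. F (of_real x)) x = (deriv ^^ n) F (of_real x)"
proof -
  let ?F = "\<lambda>n x. (deriv ^^ n) F (complex_of_real x)"
  have F: "(?F n has_vector_derivative ?F (Suc n) x) (at x)" for n x
  proof (rule has_vector_derivative_real_field)
    show "((deriv ^^ n) F has_field_derivative ?F (Suc n) x) (at (complex_of_real x))"
      using holomorphic_derivI[OF holomorphic_higher_deriv[OF assms open_UNIV] open_UNIV] by simp
  qed
  show "smooth (\<lambda>x. F (of_real x))"
    using smooth_tower[of ?F, OF F] by simp
  show "nth_vderiv n (\<lambda>x. F (of_real x)) x = ?F n x"
    using nth_vderiv_tower[of ?F, OF F] by simp
qed

lemma power_le_fact_mult_exp:
  fixes y :: real
  assumes "y \<ge> 0"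
  shows "y ^ q \<le> fact q * exp y"
proof -
  have "(\<Sum>n\<in>{q}. y ^ n /\<^sub>R fact n) \<le> exp y"
    unfolding exp_def using assms by (intro sum_le_suminf summable_exp_generic) auto
  then show ?thesis
    by (simp add: field_simps)
qed

text \<open>An entire function with a zero of order exactly n at x0 and Gaussian decay along the
  real axis.\<close>

definition gauss_mono :: "nat \<Rightarrow> real \<Rightarrow> complex \<Rightarrow> complex" where
  "gauss_mono n x0 z = (z - of_real x0) ^ n * exp (- z\<^sup>2)"

lemma holomorphic_gauss_mono: "gauss_mono n x0 holomorphic_on A"
  unfolding gauss_mono_def by (intro holomorphic_intros)

text \<open>Cauchy's inequality on the unit circle about x. There the real part of
  \<open>- w\<^sup>2\<close> is \<open>1 - x\<^sup>2 / 2\<close> minus a square, so the Gaussian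
  decay survives with half the exponent.\<close>

lemma norm_higher_deriv_gauss_mono:
  "norm ((deriv ^^ k) (gauss_mono n x0) (of_real x)) \<le>
    fact k * ((\<bar>x\<bar> + 1 + \<bar>x0\<bar>) ^ n * exp (1 - x\<^sup>2 / 2))"
proof -
  have "norm (gauss_mono n x0 w) \<le> (\<bar>x\<bar> + 1 + \<bar>x0\<bar>) ^ n * exp (1 - x\<^sup>2 / 2)"
    if w: "norm (of_real x - w) = 1" for w
  proof -
    have "norm (w - of_real x0) \<le> norm (of_real x :: complex) + norm (of_real x - w) + norm (of_real x0 :: complex)"
      by (smt (verit, best) norm_minus_commute norm_triangle_ineq4 norm_triangle_sub)
    then have 1: "norm (w - of_real x0) \<le> \<bar>x\<bar> + 1 + \<bar>x0\<bar>"
      using w by simp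
    have "(x - Re w)\<^sup>2 + (Im w)\<^sup>2 = 1"
      using w unfolding cmod_def by simp
    then have "- Re (w\<^sup>2) = 1 - x\<^sup>2 / 2 - 2 * (Re w - x / 2)\<^sup>2"
      by (simp add: power2_eq_square algebra_simps)
    then have "norm (exp (- w\<^sup>2)) \<le> exp (1 - x\<^sup>2 / 2)"
      by simp
    with 1 show ?thesis
      unfolding gauss_mono_def norm_mult norm_power by (intro mult_mono power_mono) auto
  qed
  then have "norm ((deriv ^^ k) (gauss_mono n x0) (of_real x)) \<le>
      fact k * ((\<bar>x\<bar> + 1 + \<bar>x0\<bar>) ^ n * exp (1 - x\<^sup>2 / 2)) / 1 ^ k"
    by (intro Cauchy_inequality holomorphic_gauss_mono holomorphic_on_imp_continuous_on) auto
  then show ?thesis by simp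
qed

lemma higher_deriv_gauss_mono_center:
  assumes "k \<le> n"
  shows "(deriv ^^ k) (gauss_mono n x0) (of_real x0) =
    (if k = n then fact n * exp (- (of_real x0)\<^sup>2) else 0)"
proof -
  have "(deriv ^^ k) (gauss_mono n x0) (of_real x0) =
      (\<Sum>i = 0..k. of_nat (k choose i) * (deriv ^^ i) (\<lambda>w. (w - of_real x0) ^ n) (of_real x0) *
        (deriv ^^ (k - i)) (\<lambda>w. exp (- w\<^sup>2)) (complex_of_real x0))"
    unfolding gauss_mono_def
    by (intro higher_deriv_mult[of _ UNIV]) (auto intro!: holomorphic_intros)
  also have "\<dots> = (\<Sum>i = 0..k. if i = n then fact n * exp (- (of_real x0)\<^sup>2) else 0)"
    unfolding higher_deriv_power using assms
    by (intro sum.cong) (auto simp: pochhammer_fact)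
  finally show ?thesis
    using assms by auto
qed

text \<open>The order k of the derivative costs k! by Cauchy and the power q costs q!, together at
  most \<open>exp (T * ln (T + 1))\<close> with T = k + q. The weight contributes
  \<open>exp (- d * T * ln (T + 1))\<close> up to a geometric factor, so \<open>d > 1\<close> leaves
  a positive margin \<open>d - 1\<close>.\<close>

lemma gauss_mono_in_S_space:
  assumes d: "d > 1" and \<omega>: "phi \<omega> = (\<lambda>t. exp (t / d))"
  shows "(\<lambda>x. gauss_mono n x0 (of_real x)) \<in> S_space \<omega>"
  unfolding S_space_def mem_Collect_eq
proof (intro conjI allI impI)
  show "smooth (\<lambda>x. gauss_mono n x0 (of_real x))"
    by (intro smooth_holomorphic holomorphic_gauss_mono)
  fix l :: real assume l: "l > 0"
  obtain B where B: "\<And>T::nat. l + l * T - (d - 1) * T * ln (real T + 1) \<le> B"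
    using linear_minus_entropy_bounded[of "d - 1" l l] d by auto
  \<comment> \<open>\<open>fact n\<close> pays for the power of degree n, and
    \<open>5 + \<bar>x0\<bar>\<close> bounds the collected exponent
    \<open>3 + \<bar>x0\<bar> + 2 * \<bar>x\<bar> - x\<^sup>2 / 2\<close>.\<close>
  define D where "D = fact n * exp (5 + \<bar>x0\<bar>)"
  have "(1 + \<bar>x\<bar>) ^ q * norm (nth_vderiv k (\<lambda>x. gauss_mono n x0 (of_real x)) x) *
      exp (- l * young_conj (phi \<omega>) (real (k + q) / l)) \<le> D * exp B" for x k q
  proof -
    let ?T = "real (k + q)" and ?y = "1 + \<bar>x\<bar>"
    have "fact k \<le> real k ^ k" "fact q \<le> real q ^ q"
      using fact_le_power[of k, where 'a = real] fact_le_power[of q, where 'a = real] by auto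
    moreover have "real k ^ k \<le> (?T + 1) ^ k" "real q ^ q \<le> (?T + 1) ^ q"
      by (intro power_mono; simp)+
    ultimately have "fact k * fact q \<le> (?T + 1) ^ k * (?T + 1) ^ q"
      by (intro mult_mono) auto
    also have "\<dots> = exp (?T * ln (?T + 1))"
      unfolding exp_of_nat_mult by (simp add: power_add)
    finally have fact: "fact k * fact q \<le> exp (?T * ln (?T + 1))" .
    have "?y ^ q * norm (nth_vderiv k (\<lambda>x. gauss_mono n x0 (of_real x)) x) \<le>
        (fact q * exp ?y) * (fact k * ((fact n * exp (\<bar>x\<bar> + 1 + \<bar>x0\<bar>)) * exp (1 - x\<^sup>2 / 2)))"
      unfolding nth_vderiv_holomorphic[OF holomorphic_gauss_mono]
      by (intro mult_mono power_le_fact_mult_exp order_trans[OF norm_higher_deriv_gauss_mono]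
          mult_left_mono mult_right_mono) auto
    also have "\<dots> = fact k * fact q * (fact n * exp (3 + \<bar>x0\<bar> + 2 * \<bar>x\<bar> - x\<^sup>2 / 2))"
      by (simp add: algebra_simps flip: exp_add)
    also have "\<dots> \<le> fact k * fact q * D"
    proof -
      have "0 \<le> (\<bar>x\<bar> - 2)\<^sup>2" by simp
      then have "2 * \<bar>x\<bar> - x\<^sup>2 / 2 \<le> 2"
        by (simp add: power2_eq_square algebra_simps)
      then show ?thesis
        unfolding D_def by (intro mult_left_mono) auto
    qed
    also have "\<dots> \<le> exp (?T * ln (?T + 1)) * D"
      using fact by (intro mult_right_mono) (auto simp: D_def)
    finally have deriv: "?y ^ q * norm (nth_vderiv k (\<lambda>x. gauss_mono n x0 (of_real x)) x) \<le>
      exp (?T * ln (?T + 1)) * D" .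
    have weight: "exp (- l * young_conj (phi \<omega>) (?T / l)) \<le> exp (l * (?T + 1) - d * ?T * ln (?T + 1))"
      using young_weight_le[of d l "k + q"] d l unfolding \<omega> by simp
    have "?y ^ q * norm (nth_vderiv k (\<lambda>x. gauss_mono n x0 (of_real x)) x) *
        exp (- l * young_conj (phi \<omega>) (?T / l)) \<le>
      exp (?T * ln (?T + 1)) * D * exp (l * (?T + 1) - d * ?T * ln (?T + 1))"
      by (rule mult_mono[OF deriv weight]) (auto simp: D_def)
    also have "\<dots> = D * exp (l + l * ?T - (d - 1) * ?T * ln (?T + 1))"
      by (simp add: algebra_simps flip: exp_add)
    also have "\<dots> \<le> D * exp B"
      using B[of "k + q"] by (intro mult_left_mono) (auto simp: D_def)
    finally show ?thesis .
  qed
  then have "p_seminorm \<omega> l (\<lambda>x. gauss_mono n x0 (of_real x)) \<le> ennreal (D * exp B)"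
    unfolding p_seminorm_le_iff by (intro allI ennreal_leI)
  then show "p_seminorm \<omega> l (\<lambda>x. gauss_mono n x0 (of_real x)) < \<infinity>"
    using le_less_trans[OF _ ennreal_less_top] by simp
qed

text \<open>All derivatives of order below n vanish at x0 = P x0, so only the diagonal coefficient,
  the n-th power of P', survives.\<close>

lemma nth_vderiv_gauss_mono_comp:
  assumes "poly P x0 = x0"
  shows "nth_vderiv n ((\<lambda>x. gauss_mono n x0 (of_real x)) \<circ> poly P) x0 =
    of_real (poly (pderiv P) x0 ^ n * (fact n * exp (- x0\<^sup>2)))"
proof -
  have "nth_vderiv n ((\<lambda>x. gauss_mono n x0 (of_real x)) \<circ> poly P) x0 =
      (\<Sum>j\<le>n. if j = n then of_real (poly (comp_coeff P n n) x0) * (fact n * exp (- (of_real x0)\<^sup>2)) else 0)"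
    unfolding nth_vderiv_comp_poly[OF smooth_holomorphic[OF holomorphic_gauss_mono]] assms
      nth_vderiv_holomorphic[OF holomorphic_gauss_mono]
    by (intro sum.cong) (auto simp: higher_deriv_gauss_mono_center)
  then show ?thesis
    by (simp add: comp_coeff_diag exp_of_real[symmetric])
qed

text \<open>The order of choices is decisive: C is given first, then n is taken with
  \<bar>\<mu>\<bar>^n > C, which fixes one test function, and finally k tends to infinity.\<close>

lemma not_m_topologizable_iterates:
  assumes d: "d > 1" and \<omega>: "phi \<omega> = (\<lambda>t. exp (t / d))"
    and fp: "poly \<psi> x0 = x0" and rep: "\<bar>poly (pderiv \<psi>) x0\<bar> > 1"
  shows "\<not> m_topologizable (S_space \<omega>) (S_seminorms \<omega>) (S_seminorms \<sigma>) (iter_comp_op \<psi>)"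
proof
  assume "m_topologizable (S_space \<omega>) (S_seminorms \<omega>) (S_seminorms \<sigma>) (iter_comp_op \<psi>)"
  moreover have "p_seminorm \<sigma> 1 \<in> S_seminorms \<sigma>"
    by (auto simp: S_seminorms_def intro: exI[of _ 1])
  ultimately obtain q C where q: "q \<in> S_seminorms \<omega>" and C: "C \<ge> 1"
    and bound: "\<And>k f. k \<ge> 1 \<Longrightarrow> f \<in> S_space \<omega> \<Longrightarrow>
      p_seminorm \<sigma> 1 (iter_comp_op \<psi> k f) \<le> ennreal (C ^ k) * q f"
    unfolding m_topologizable_def by blast
  from q obtain l where l: "l > 0" and q: "q = p_seminorm \<omega> l"
    unfolding S_seminorms_def by blast
  let ?\<mu> = "\<bar>poly (pderiv \<psi>) x0\<bar>"
  obtain n where n: "C < ?\<mu> ^ n"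
    using real_arch_pow[OF rep] by blast
  define f where "f = (\<lambda>x. gauss_mono n x0 (complex_of_real x))"
  have f: "f \<in> S_space \<omega>"
    unfolding f_def by (rule gauss_mono_in_S_space[OF d \<omega>])
  then obtain M where M: "M \<ge> 0" "q f = ennreal M"
    using l unfolding S_space_def q by (cases "p_seminorm \<omega> l f" rule: ennreal_cases) auto
  \<comment> \<open>The term of order n with q = 0 at x0 in the seminorm of f itself; passing to the
    k-th iterate multiplies it by \<open>?\<mu> ^ (k * n)\<close>.\<close>
  define a where "a = fact n * exp (- x0\<^sup>2) * exp (- young_conj (phi \<sigma>) (real n))"
  have a: "a > 0" by (simp add: a_def)
  define r where "r = ?\<mu> ^ n / C"
  have r: "r > 1" using n C by (simp add: r_def)
  have le: "r ^ k * a \<le> M" if k: "k \<ge> 1" for k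
  proof -
    have "ennreal (norm (nth_vderiv n (iter_comp_op \<psi> k f) x0) *
        exp (- young_conj (phi \<sigma>) (real n))) \<le> ennreal (C ^ k) * ennreal M"
      using order_trans[OF p_seminorm_term_le[of x0 0 n _ 1 \<sigma>] bound[OF k f]] M by simp
    moreover have "norm (nth_vderiv n (iter_comp_op \<psi> k f) x0) = ?\<mu> ^ (k * n) * (fact n * exp (- x0\<^sup>2))"
      unfolding iter_comp_op_def poly_poly_iter[symmetric] f_def
        nth_vderiv_gauss_mono_comp[OF poly_iter_fixpoint[OF fp]] poly_pderiv_poly_iter[OF fp] norm_of_real
      by (simp add: abs_mult power_abs power_mult)
    ultimately have "ennreal (?\<mu> ^ (k * n) * a) \<le> ennreal (C ^ k * M)"
      using C M by (simp add: a_def ennreal_mult mult_ac)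
    then have "?\<mu> ^ (k * n) * a \<le> C ^ k * M"
      using C M by (subst (asm) ennreal_le_iff) auto
    then show ?thesis
      using C by (simp add: r_def power_divide field_simps flip: power_mult)
  qed
  \<comment> \<open>The estimate \<open>le\<close> requires k \<ge> 1, while the Archimedean
    property may return 0; hence the passage to \<open>Suc k\<close>.\<close>
  obtain k where "M / a < r ^ k"
    using real_arch_pow[OF r] by blast
  also have "r ^ k \<le> r ^ Suc k"
    using r by (intro power_increasing) auto
  finally have "M < r ^ Suc k * a"
    using a by (simp only: pos_divide_less_eq)
  with le[of "Suc k"] show False by simp
qed

theorem theorem2p4:
  fixes \<psi> :: "real poly" and d :: real and \<omega> \<sigma> :: "real \<Rightarrow> real"
  assumes "degree \<psi> > 1"
    and "\<exists>x0. poly \<psi> x0 = x0 \<and> \<bar>poly (pderiv \<psi>) x0\<bar> > 1"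
    and "d > 1"
    and "\<omega> = (\<lambda>t. \<bar>t\<bar> powr (1 / d))"
    and "\<sigma> = (\<lambda>t. \<omega> (t powr (1 / 2)))"
  shows "(\<forall>m\<ge>1. cont_lin_op (S_space \<omega>) (S_seminorms \<omega>) (S_space \<sigma>) (S_seminorms \<sigma>)
                  (iter_comp_op \<psi> m)) \<and>
         \<not> m_topologizable (S_space \<omega>) (S_seminorms \<omega>) (S_seminorms \<sigma>) (iter_comp_op \<psi>)"
proof (intro conjI allI impI)
  have \<omega>: "phi \<omega> = (\<lambda>t. exp (t / d))"
    unfolding assms(4) phi_def by (auto simp: powr_def)
  \<comment> \<open>Replacing t by its square root in the weight doubles d; this is the margin used
    for continuity.\<close>
  have \<sigma>: "phi \<sigma> = (\<lambda>t. exp (t / (2 * d)))"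
    unfolding assms(4,5) phi_def by (auto simp: powr_def)
  show "\<not> m_topologizable (S_space \<omega>) (S_seminorms \<omega>) (S_seminorms \<sigma>) (iter_comp_op \<psi>)"
    using not_m_topologizable_iterates[OF assms(3) \<omega>] assms(2) by blast
  fix m :: nat
  show "cont_lin_op (S_space \<omega>) (S_seminorms \<omega>) (S_space \<sigma>) (S_seminorms \<sigma>) (iter_comp_op \<psi> m)"
  proof (rule cont_lin_op_S_space)
    show "smooth (iter_comp_op \<psi> m f)" if "smooth f" for f
      unfolding iter_comp_op_def poly_poly_iter[symmetric] by (rule smooth_comp_poly[OF that])
    show "iter_comp_op \<psi> m (\<lambda>x. a * f x + b * g x) =
        (\<lambda>x. a * iter_comp_op \<psi> m f x + b * iter_comp_op \<psi> m g x)" for f g a b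
      by (simp add: iter_comp_op_def o_def)
    fix l :: real assume l: "l > 0"
    \<comment> \<open>The iterate is handled as one composition with a single polynomial, since each
      use of the composition bound already passes from \<omega> to \<sigma>.\<close>
    have "degree (poly_iter \<psi> m) > 0"
      using assms(1) by (simp add: degree_poly_iter)
    then obtain B where "B > 0" "\<And>f. smooth f \<Longrightarrow>
        p_seminorm \<sigma> l (f \<circ> poly (poly_iter \<psi> m)) \<le> ennreal B * p_seminorm \<omega> 1 f"
      using p_seminorm_comp_poly[of d \<omega> \<sigma> "poly_iter \<psi> m" l] \<omega> \<sigma> assms(3) l by auto
    then show "\<exists>k>0. \<exists>B>0. \<forall>f. smooth f \<longrightarrow>
        p_seminorm \<sigma> l (iter_comp_op \<psi> m f) \<le> ennreal B * p_seminorm \<omega> k f"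
      unfolding iter_comp_op_def poly_poly_iter by (intro exI[of _ 1] conjI exI[of _ B]) auto
  qed
qed

end
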